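(* For any $\delta\in\left(0,(\beta_0-\alpha_0)/2\right)$ and $r\in\mathcal R_\delta=[\alpha_0+\delta,\beta_0-\delta]$, there exists $\varepsilon_\delta>0$ such that, if $\varepsilon\in(0,\varepsilon_\delta)$, then the energy $E^0_{\varepsilon r}=E_\varepsilon[z_{\varepsilon r}]$ of the Maxwell solution is strictly less than the energy $E_\varepsilon$ of constant solutions of the problem $$Q''(\varepsilon z')z''=F'(z)-\sigma\ \text{ in }(-\varepsilon^{-1},\varepsilon^{-1}),\qquad z'(\pm\varepsilon^{-1})=0,\qquad \int_{-\varepsilon^{-1}}^{\varepsilon^{-1}}z(x)\,dx=2r\varepsilon^{-1}$$ (with unknowns the positive function $z$ and the constant $\sigma\in\mathbb R$).
   Context: $Q(s)=\sqrt{1+s^2}-1$. Fix $0<\overline\alpha<\underline\beta$ and $F\in C^5(0,\infty)$ (real valued) with $F''>0$ on $(0,\overline\alpha)\cup(\underline\beta,\infty)$, $F''<0$ on $(\overline\alpha,\underline\beta)$, $F'(0)<F'(\underline\beta)$ and $F'(\infty)>F'(\overline\alpha)$, where $F'(0),F'(\infty)$ denote the limits of $F'$ at $0^+$ and $+\infty$. Put $\underline\sigma:=F'(\underline\beta)$, $\overline\sigma:=F'(\overline\alpha)$ and, for $\sigma\in[\underline\sigma,\overline\sigma]$, let $\Phi_\sigma(z):=F(z)-\sigma z$. Its critical points are $\alpha_\sigma\le\zeta_\sigma\le\beta_\sigma$, the solutions of $F'(\cdot)=\sigma$ in $(0,\overline\alpha]$, $[\overline\alpha,\underline\beta]$, $[\underline\beta,\infty)$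 respectively. The value $\sigma_0\in(\underline\sigma,\overline\sigma)$ is the unique one for which $\Phi_{\sigma_0}(\alpha_{\sigma_0})=\Phi_{\sigma_0}(\beta_{\sigma_0})$; write $\alpha_0=\alpha_{\sigma_0}$, $\beta_0=\beta_{\sigma_0}$, $b_0=\Phi_{\sigma_0}(\alpha_0)=\Phi_{\sigma_0}(\beta_0)$, $\Delta_0=(\sigma_0,b_0)$ (Maxwell point). A pair $\Delta=(\sigma,b)$ is admissible if $\sigma\in(\underline\sigma,\overline\sigma)$ and $\max\{\Phi_\sigma(\alpha_\sigma),\Phi_\sigma(\beta_\sigma)\}<b<\Phi_\sigma(\zeta_\sigma)$. A simple solution of the problem in the claim is a (non-constant) increasing solution; it satisfies $P_\varepsilon(z')=\Phi_\sigma(z)-b$ for a constant $b$, with $P_\varepsilon(s)=\varepsilon^{-2}\bigl(1-\tfrac{1}{\sqrt{1+\varepsilon^2s^2}}\bigr)$, and its corresponding admissible pair is $\Delta=(\sigma,b)$. Maxwell solution: for every $\delta\in(0,(\beta_0-\alpha_0)/2)$ there exist $\varepsilon_\delta>0$ and a neighborhood $\mathcal N_\delta$ of $\Delta_0$ such that for $\varepsilon\in(0,\varepsilon_\delta)$ and $r\in\mathcal R_\delta$ there is exactly one simple solution whose admissible pair $\Delta(\varepsilon,r)$ lies in $\mathcal N_\delta$, and $\Delta(\varepsilon,r)=\Delta_0+O(\exp(-C/\varepsilon))$ as $\varepsilon\to0^+$ uniformly in $r\in\mathcal R_\delta$, for some $C=C_\delta>0$. This solution is the Maxwell solution $z_{\varepsilon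 r}$. The energy is $E_\varepsilon[z]=\varepsilon\int_{-\varepsilon^{-1}}^{\varepsilon^{-1}}\left[\frac{Q(\varepsilon z'(t))}{\varepsilon^2}+F(z(t))\right]dt$. *)

theory Defs
  imports "HOL-Analysis.Analysis"
begin

definition C_k_on :: "nat \<Rightarrow> (real \<Rightarrow> real) \<Rightarrow> real set \<Rightarrow> bool" where
  "C_k_on k f S \<longleftrightarrow>
     (\<forall>j<k. (deriv ^^ j) f differentiable_on S) \<and> continuous_on S ((deriv ^^ k) f)"

text \<open>
  In all that follows \<open>a\<close> and \<open>b\<close> are the two inflection points (\<open>\<alpha>\<close> with a bar above and
  \<open>\<beta>\<close> with a bar below). The one-sided limits of \<open>F'\<close> at \<open>0\<close> and at infinity are taken in the
  extended reals, since \<open>F'\<close> may be unbounded there.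
\<close>

definition double_well :: "(real \<Rightarrow> real) \<Rightarrow> real \<Rightarrow> real \<Rightarrow> bool" where
  "double_well F a b \<longleftrightarrow>
     0 < a \<and> a < b \<and> C_k_on 5 F {0<..} \<and>
     (\<forall>z\<in>{0<..<a} \<union> {b<..}. (deriv ^^ 2) F z > 0) \<and>
     (\<forall>z\<in>{a<..<b}. (deriv ^^ 2) F z < 0) \<and>
     (\<exists>L. ((\<lambda>z. ereal (deriv F z)) \<longlongrightarrow> L) (at_right 0) \<and> L < ereal (deriv F b)) \<and>
     (\<exists>L. ((\<lambda>z. ereal (deriv F z)) \<longlongrightarrow> L) at_top \<and> L > ereal (deriv F a))"

definition Phi :: "(real \<Rightarrow> real) \<Rightarrow> real \<Rightarrow> real \<Rightarrow> real" where
  "Phi F \<sigma> z = F z - \<sigma> * z"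

definition alpha_crit :: "(real \<Rightarrow> real) \<Rightarrow> real \<Rightarrow> real \<Rightarrow> real" where
  "alpha_crit F a \<sigma> = (THE z. z \<in> {0<..a} \<and> deriv F z = \<sigma>)"

definition zeta_crit :: "(real \<Rightarrow> real) \<Rightarrow> real \<Rightarrow> real \<Rightarrow> real \<Rightarrow> real" where
  "zeta_crit F a b \<sigma> = (THE z. z \<in> {a..b} \<and> deriv F z = \<sigma>)"

definition beta_crit :: "(real \<Rightarrow> real) \<Rightarrow> real \<Rightarrow> real \<Rightarrow> real" where
  "beta_crit F b \<sigma> = (THE z. z \<in> {b..} \<and> deriv F z = \<sigma>)"

definition sigma0 :: "(real \<Rightarrow> real) \<Rightarrow> real \<Rightarrow> real \<Rightarrow> real" where
  "sigma0 F a b = (THE \<sigma>. \<sigma> \<in> {deriv F b<..<deriv F a} \<and>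
     Phi F \<sigma> (alpha_crit F a \<sigma>) = Phi F \<sigma> (beta_crit F b \<sigma>))"

definition alpha0 :: "(real \<Rightarrow> real) \<Rightarrow> real \<Rightarrow> real \<Rightarrow> real" where
  "alpha0 F a b = alpha_crit F a (sigma0 F a b)"

definition beta0 :: "(real \<Rightarrow> real) \<Rightarrow> real \<Rightarrow> real \<Rightarrow> real" where
  "beta0 F a b = beta_crit F b (sigma0 F a b)"

definition maxwell_point :: "(real \<Rightarrow> real) \<Rightarrow> real \<Rightarrow> real \<Rightarrow> real \<times> real" where
  "maxwell_point F a b = (sigma0 F a b, Phi F (sigma0 F a b) (alpha0 F a b))"

definition admissible :: "(real \<Rightarrow> real) \<Rightarrow> real \<Rightarrow> real \<Rightarrow> real \<times> real \<Rightarrow> bool" where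
  "admissible F a b \<Delta> \<longleftrightarrow> (case \<Delta> of (\<sigma>, c) \<Rightarrow>
     \<sigma> \<in> {deriv F b<..<deriv F a} \<and>
     max (Phi F \<sigma> (alpha_crit F a \<sigma>)) (Phi F \<sigma> (beta_crit F b \<sigma>)) < c \<and>
     c < Phi F \<sigma> (zeta_crit F a b \<sigma>))"

definition Q :: "real \<Rightarrow> real" where
  "Q s = sqrt (1 + s\<^sup>2) - 1"

definition P :: "real \<Rightarrow> real \<Rightarrow> real" where
  "P \<epsilon> s = (1 - 1 / sqrt (1 + \<epsilon>\<^sup>2 * s\<^sup>2)) / \<epsilon>\<^sup>2"

definition dom :: "real \<Rightarrow> real set" where
  "dom \<epsilon> = {- (1 / \<epsilon>)..1 / \<epsilon>}"

text \<open>The derivative on the closed interval, one-sided at the end points, so that values of \<open>z\<close>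
  outside the interval play no role.\<close>

definition D :: "real \<Rightarrow> (real \<Rightarrow> real) \<Rightarrow> real \<Rightarrow> real" where
  "D \<epsilon> z x = vector_derivative z (at x within dom \<epsilon>)"

text \<open>Classical solutions: \<open>z\<close> is continuously differentiable up to the boundary and twice
  differentiable inside; continuity of the second derivative then follows from the equation.\<close>

definition solution :: "(real \<Rightarrow> real) \<Rightarrow> real \<Rightarrow> real \<Rightarrow> (real \<Rightarrow> real) \<Rightarrow> real \<Rightarrow> bool" where
  "solution F \<epsilon> r z \<sigma> \<longleftrightarrow>
     (\<forall>x\<in>dom \<epsilon>. 0 < z x) \<and>
     z differentiable_on dom \<epsilon> \<and> continuous_on (dom \<epsilon>) (D \<epsilon> z) \<and>
     (\<forall>x\<in>{- (1 / \<epsilon>)<..<1 / \<epsilon>}. D \<epsilon> z differentiable at x \<and>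
        (deriv ^^ 2) Q (\<epsilon> * D \<epsilon> z x) * deriv (D \<epsilon> z) x = deriv F (z x) - \<sigma>) \<and>
     D \<epsilon> z (- (1 / \<epsilon>)) = 0 \<and> D \<epsilon> z (1 / \<epsilon>) = 0 \<and>
     integral (dom \<epsilon>) z = 2 * r / \<epsilon>"

definition constant_solution ::
    "(real \<Rightarrow> real) \<Rightarrow> real \<Rightarrow> real \<Rightarrow> (real \<Rightarrow> real) \<Rightarrow> bool" where
  "constant_solution F \<epsilon> r z \<longleftrightarrow> (\<exists>\<sigma>. solution F \<epsilon> r z \<sigma>) \<and> z constant_on dom \<epsilon>"

definition simple_solution ::
    "(real \<Rightarrow> real) \<Rightarrow> real \<Rightarrow> real \<Rightarrow> (real \<Rightarrow> real) \<Rightarrow> real \<Rightarrow> bool" where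
  "simple_solution F \<epsilon> r z \<sigma> \<longleftrightarrow>
     solution F \<epsilon> r z \<sigma> \<and> mono_on (dom \<epsilon>) z \<and> \<not> z constant_on dom \<epsilon>"

definition simple_solution_with_pair ::
    "(real \<Rightarrow> real) \<Rightarrow> real \<Rightarrow> real \<Rightarrow> real \<Rightarrow> real \<Rightarrow> (real \<Rightarrow> real) \<Rightarrow> real \<times> real \<Rightarrow> bool" where
  "simple_solution_with_pair F a b \<epsilon> r z \<Delta> \<longleftrightarrow> (case \<Delta> of (\<sigma>, c) \<Rightarrow>
     simple_solution F \<epsilon> r z \<sigma> \<and> admissible F a b (\<sigma>, c) \<and>
     (\<forall>x\<in>dom \<epsilon>. P \<epsilon> (D \<epsilon> z x) = Phi F \<sigma> (z x) - c))"

definition R_set :: "(real \<Rightarrow> real) \<Rightarrow> real \<Rightarrow> real \<Rightarrow> real \<Rightarrow> real set" where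
  "R_set F a b \<delta> = {alpha0 F a b + \<delta>..beta0 F a b - \<delta>}"

text \<open>\<open>z \<epsilon> r\<close> is the Maxwell solution and \<open>\<Delta> \<epsilon> r\<close> its admissible pair, relative to a bound \<open>\<epsilon>1\<close>
  and a neighbourhood \<open>N\<close> of the Maxwell point for which existence, uniqueness and exponential
  closeness hold. Solutions are identified when they agree on the closed interval.\<close>

definition maxwell_solutions ::
    "(real \<Rightarrow> real) \<Rightarrow> real \<Rightarrow> real \<Rightarrow> real \<Rightarrow> real \<Rightarrow> (real \<times> real) set \<Rightarrow>
     (real \<Rightarrow> real \<Rightarrow> real \<Rightarrow> real) \<Rightarrow> (real \<Rightarrow> real \<Rightarrow> real \<times> real) \<Rightarrow> bool" where
  "maxwell_solutions F a b \<delta> \<epsilon>1 N z \<Delta> \<longleftrightarrow>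
     0 < \<epsilon>1 \<and> maxwell_point F a b \<in> interior N \<and>
     (\<forall>\<epsilon>\<in>{0<..<\<epsilon>1}. \<forall>r\<in>R_set F a b \<delta>.
        simple_solution_with_pair F a b \<epsilon> r (z \<epsilon> r) (\<Delta> \<epsilon> r) \<and> \<Delta> \<epsilon> r \<in> N \<and>
        (\<forall>w \<Gamma>. simple_solution_with_pair F a b \<epsilon> r w \<Gamma> \<and> \<Gamma> \<in> N \<longrightarrow>
           (\<forall>x\<in>dom \<epsilon>. w x = z \<epsilon> r x))) \<and>
     (\<exists>C>0. \<exists>K. \<forall>\<^sub>F \<epsilon> in at_right 0. \<forall>r\<in>R_set F a b \<delta>.
        norm (\<Delta> \<epsilon> r - maxwell_point F a b) \<le> K * exp (- C / \<epsilon>))"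

definition energy :: "(real \<Rightarrow> real) \<Rightarrow> real \<Rightarrow> (real \<Rightarrow> real) \<Rightarrow> real" where
  "energy F \<epsilon> z = \<epsilon> * integral (dom \<epsilon>) (\<lambda>t. Q (\<epsilon> * D \<epsilon> z t) / \<epsilon>\<^sup>2 + F (z t))"

end

theory Submission
  imports Defs
begin

text \<open>
  Along a simple solution with pair \<open>(\<sigma>, c)\<close> the conservation law gives
  \<open>F z = P \<epsilon> z' + c + \<sigma> z\<close>, and \<open>Q (\<epsilon> s) / \<epsilon>\<^sup>2 + P \<epsilon> s \<le> s sqrt (2 P \<epsilon> s)\<close> for \<open>s \<ge> 0\<close>. As \<open>z\<close> stays
  between \<open>\<alpha>\<^sub>\<sigma>\<close> and \<open>\<beta>\<^sub>\<sigma>\<close>, the quantity \<open>P \<epsilon> z' = \<Phi>\<^sub>\<sigma> z - c\<close> is bounded, and integration of the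
  increasing \<open>z\<close> yields an energy of at most \<open>2 (c + \<sigma> r) + O(\<epsilon>)\<close>. The constant solution has energy
  \<open>2 F r\<close>. The difference is at least \<open>2 (\<Phi>\<^sub>\<sigma> r - c) - O(\<epsilon>)\<close>, which is positive because \<open>\<Phi>\<close> at the
  Maxwell value exceeds its minimum \<open>b\<^sub>0\<close> uniformly on \<open>[\<alpha>\<^sub>0 + \<delta>, \<beta>\<^sub>0 - \<delta>]\<close>.
\<close>

section \<open>Critical points of the double well\<close>

context
  fixes F :: "real \<Rightarrow> real" and a b :: real
  assumes dw: "double_well F a b"
begin

lemma inflection_points: "0 < a" "a < b" "0 < b"
  using dw by (auto simp: double_well_def)

lemma F_has_derivative: "(F has_real_derivative deriv F x) (at x)" if "0 < x"
proof -
  have "\<forall>j<5. (deriv ^^ j) F differentiable_on {0<..}"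
    using dw by (auto simp: double_well_def C_k_on_def)
  from this[rule_format, of 0] have "F differentiable_on {0<..}" by simp
  then have "F differentiable (at x)"
    using that by (auto simp: differentiable_on_eq_differentiable_at)
  then show ?thesis
    by (simp add: DERIV_deriv_iff_real_differentiable)
qed

lemma dF_has_derivative: "(deriv F has_real_derivative (deriv ^^ 2) F x) (at x)" if "0 < x"
proof -
  have "\<forall>j<5. (deriv ^^ j) F differentiable_on {0<..}"
    using dw by (auto simp: double_well_def C_k_on_def)
  from this[rule_format, of 1] have "deriv F differentiable_on {0<..}" by simp
  then have "deriv F differentiable (at x)"
    using that by (auto simp: differentiable_on_eq_differentiable_at)
  then show ?thesis
    by (simp add: DERIV_deriv_iff_real_differentiable numeral_2_eq_2)
qed

lemma continuous_on_F: "continuous_on {0<..} F"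
  using F_has_derivative by (meson DERIV_isCont continuous_at_imp_continuous_on greaterThan_iff)

lemma continuous_on_dF: "continuous_on {0<..} (deriv F)"
  using dF_has_derivative by (meson DERIV_isCont continuous_at_imp_continuous_on greaterThan_iff)

text \<open>The sign of \<open>F''\<close> is known on the open interval only; continuity of
  \<open>F'\<close> lets the inflection point \<open>a\<close> be included.\<close>

lemma dF_less_left: "deriv F x < deriv F y" if "0 < x" "x < y" "y \<le> a"
proof (rule DERIV_pos_imp_increasing_open[OF that(2)])
  fix t assume "x < t" "t < y"
  then show "\<exists>d. (deriv F has_real_derivative d) (at t) \<and> 0 < d"
    using that dF_has_derivative[of t] dw unfolding double_well_def by force
qed (rule continuous_on_subset[OF continuous_on_dF], use that in auto)

lemma dF_less_right: "deriv F x < deriv F y" if "b \<le> x" "x < y"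
proof (rule DERIV_pos_imp_increasing_open[OF that(2)])
  fix t assume "x < t" "t < y"
  then show "\<exists>d. (deriv F has_real_derivative d) (at t) \<and> 0 < d"
    using that inflection_points dF_has_derivative[of t] dw unfolding double_well_def by force
qed (rule continuous_on_subset[OF continuous_on_dF], use that inflection_points in auto)

lemma dF_greater_middle: "deriv F y < deriv F x" if "a \<le> x" "x < y" "y \<le> b"
proof (rule DERIV_neg_imp_decreasing_open[OF that(2)])
  fix t assume "x < t" "t < y"
  then show "\<exists>d. (deriv F has_real_derivative d) (at t) \<and> d < 0"
    using that inflection_points dF_has_derivative[of t] dw unfolding double_well_def by force
qed (rule continuous_on_subset[OF continuous_on_dF], use that inflection_points in auto)

lemma dF_less_right_iff: "deriv F x < deriv F y \<longleftrightarrow> x < y" if "b \<le> x" "b \<le> y"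
  using that dF_less_right by (metis less_asym linorder_neqE_linordered_idom)

lemma dF_less_left_iff: "deriv F x < deriv F y \<longleftrightarrow> x < y" if "0 < x" "x \<le> a" "0 < y" "y \<le> a"
  using that dF_less_left by (metis less_asym linorder_neqE_linordered_idom)

text \<open>The limits of \<open>F'\<close> at zero and at infinity enter here. The two points
  enclose \<open>alpha_crit\<close> and \<open>beta_crit\<close> for all relevant \<sigma> at once,
  so bounds on \<open>{l..u}\<close> are uniform in \<sigma>.\<close>

lemma outer_points:
  obtains l u where "0 < l" "l < a" "deriv F l < deriv F b" "b < u" "deriv F a < deriv F u"
proof -
  from dw obtain L where L: "((\<lambda>z. ereal (deriv F z)) \<longlongrightarrow> L) (at_right 0)" "L < ereal (deriv F b)"
    by (auto simp: double_well_def)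
  have "eventually (\<lambda>z. ereal (deriv F z) < ereal (deriv F b)) (at_right 0)"
    using order_tendstoD(2)[OF L] .
  then obtain e where e: "e > 0" "\<And>z. 0 < z \<Longrightarrow> z < e \<Longrightarrow> deriv F z < deriv F b"
    by (auto simp: eventually_at_right_field)
  from dw obtain U where U: "((\<lambda>z. ereal (deriv F z)) \<longlongrightarrow> U) at_top" "ereal (deriv F a) < U"
    by (auto simp: double_well_def)
  have "eventually (\<lambda>z. ereal (deriv F a) < ereal (deriv F z)) at_top"
    using order_tendstoD(1)[OF U] .
  then obtain k where k: "\<And>z. z \<ge> k \<Longrightarrow> deriv F a < deriv F z"
    by (auto simp: eventually_at_top_linorder)
  show thesis
    by (rule that[of "min e a / 2" "max k (b + 1)"]) (use e k inflection_points in auto)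
qed

text \<open>The intermediate value theorem on \<open>{l..a}\<close> and strict monotonicity of
  \<open>F'\<close> make the definite description meaningful. The same scheme on
  \<open>{b..u}\<close> serves \<open>beta_crit\<close>.\<close>

lemma alpha_crit:
  assumes "deriv F b \<le> \<sigma>" "\<sigma> \<le> deriv F a"
  shows "0 < alpha_crit F a \<sigma>" "alpha_crit F a \<sigma> \<le> a" "deriv F (alpha_crit F a \<sigma>) = \<sigma>"
proof -
  obtain l where l: "0 < l" "l < a" "deriv F l < deriv F b" using outer_points by blast
  have "\<exists>x\<ge>l. x \<le> a \<and> deriv F x = \<sigma>"
    by (rule IVT') (use l assms in \<open>auto intro: continuous_on_subset[OF continuous_on_dF]\<close>)
  then obtain x where "l \<le> x" "x \<le> a" "deriv F x = \<sigma>" by blast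
  then have "\<exists>x. x \<in> {0<..a} \<and> deriv F x = \<sigma>" using l by (intro exI[of _ x]) auto
  then have "\<exists>!x. x \<in> {0<..a} \<and> deriv F x = \<sigma>"
    using dF_less_left by (metis greaterThanAtMost_iff less_irrefl linorder_neqE_linordered_idom)
  from theI'[OF this]
  show "0 < alpha_crit F a \<sigma>" "alpha_crit F a \<sigma> \<le> a" "deriv F (alpha_crit F a \<sigma>) = \<sigma>"
    by (auto simp: alpha_crit_def)
qed

lemma beta_crit:
  assumes "deriv F b \<le> \<sigma>" "\<sigma> \<le> deriv F a"
  shows "b \<le> beta_crit F b \<sigma>" "deriv F (beta_crit F b \<sigma>) = \<sigma>"
proof -
  obtain u where u: "b < u" "deriv F a < deriv F u" using outer_points by blast
  have "\<exists>x\<ge>b. x \<le> u \<and> deriv F x = \<sigma>"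
    by (rule IVT') (use u assms inflection_points in
        \<open>auto intro: continuous_on_subset[OF continuous_on_dF]\<close>)
  then have "\<exists>x. x \<in> {b..} \<and> deriv F x = \<sigma>" using u by force
  then have "\<exists>!x. x \<in> {b..} \<and> deriv F x = \<sigma>"
    using dF_less_right by (metis atLeast_iff less_irrefl linorder_neqE_linordered_idom)
  from theI'[OF this] show "b \<le> beta_crit F b \<sigma>" "deriv F (beta_crit F b \<sigma>) = \<sigma>"
    by (auto simp: beta_crit_def)
qed

section \<open>Monotonicity of the tilted potential and its two wells\<close>

lemma Phi_has_derivative:
  "(Phi F \<sigma> has_real_derivative deriv F x - \<sigma>) (at x)" if "0 < x"
  unfolding Phi_def
  by (rule derivative_eq_intros F_has_derivative that refl | simp)+

lemma continuous_on_Phi: "continuous_on {0<..} (Phi F \<sigma>)"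
  unfolding Phi_def by (intro continuous_intros continuous_on_F)

lemma Phi_less:
  assumes "0 < x" "x < y" "\<And>t. x < t \<Longrightarrow> t < y \<Longrightarrow> \<sigma> < deriv F t"
  shows "Phi F \<sigma> x < Phi F \<sigma> y"
proof (rule DERIV_pos_imp_increasing_open[OF assms(2)])
  fix t assume "x < t" "t < y"
  then show "\<exists>d. (Phi F \<sigma> has_real_derivative d) (at t) \<and> 0 < d"
    using assms Phi_has_derivative[of t \<sigma>] by force
qed (rule continuous_on_subset[OF continuous_on_Phi], use assms in auto)

lemma Phi_greater:
  assumes "0 < x" "x < y" "\<And>t. x < t \<Longrightarrow> t < y \<Longrightarrow> deriv F t < \<sigma>"
  shows "Phi F \<sigma> y < Phi F \<sigma> x"
proof (rule DERIV_neg_imp_decreasing_open[OF assms(2)])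
  fix t assume "x < t" "t < y"
  then show "\<exists>d. (Phi F \<sigma> has_real_derivative d) (at t) \<and> d < 0"
    using assms Phi_has_derivative[of t \<sigma>] by force
qed (rule continuous_on_subset[OF continuous_on_Phi], use assms in auto)

text \<open>The derivative \<open>F' - \<sigma>\<close> changes sign from negative to positive at
  the critical point, because \<open>F'\<close> increases on \<open>{0<..a}\<close>.\<close>

lemma Phi_alpha_crit_le:
  assumes "deriv F b \<le> \<sigma>" "\<sigma> \<le> deriv F a" "0 < x" "x \<le> a"
  shows "Phi F \<sigma> (alpha_crit F a \<sigma>) \<le> Phi F \<sigma> x"
proof -
  note A = alpha_crit[OF assms(1,2)]
  consider "x < alpha_crit F a \<sigma>" | "x = alpha_crit F a \<sigma>" | "alpha_crit F a \<sigma> < x" by linarith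
  then show ?thesis
  proof cases
    case 1
    have "deriv F t < \<sigma>" if "x < t" "t < alpha_crit F a \<sigma>" for t
      using that A assms dF_less_left[of t "alpha_crit F a \<sigma>"] by auto
    then show ?thesis using Phi_greater[OF assms(3) 1] by fastforce
  next
    case 3
    have "\<sigma> < deriv F t" if "alpha_crit F a \<sigma> < t" "t < x" for t
      using that A assms dF_less_left[of "alpha_crit F a \<sigma>" t] by auto
    then show ?thesis using Phi_less[OF A(1) 3] by fastforce
  qed simp
qed

lemma Phi_beta_crit_le:
  assumes "deriv F b \<le> \<sigma>" "\<sigma> \<le> deriv F a" "b \<le> x"
  shows "Phi F \<sigma> (beta_crit F b \<sigma>) \<le> Phi F \<sigma> x"
proof -
  note B = beta_crit[OF assms(1,2)]
  have pos: "0 < x" "0 < beta_crit F b \<sigma>" using assms B inflection_points by auto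
  consider "x < beta_crit F b \<sigma>" | "x = beta_crit F b \<sigma>" | "beta_crit F b \<sigma> < x" by linarith
  then show ?thesis
  proof cases
    case 1
    have "deriv F t < \<sigma>" if "x < t" "t < beta_crit F b \<sigma>" for t
      using that B assms dF_less_right[of t "beta_crit F b \<sigma>"] by auto
    then show ?thesis using Phi_greater[OF pos(1) 1] by fastforce
  next
    case 3
    have "\<sigma> < deriv F t" if "beta_crit F b \<sigma> < t" "t < x" for t
      using that B assms dF_less_right[of "beta_crit F b \<sigma>" t] by auto
    then show ?thesis using Phi_less[OF pos(2) 3] by fastforce
  qed simp
qed

section \<open>The Maxwell point\<close>

text \<open>The difference in depth of the two wells; the Maxwell value is its zero.\<close>

definition gap :: "real \<Rightarrow> real" where
  "gap \<sigma> = Phi F \<sigma> (alpha_crit F a \<sigma>) - Phi F \<sigma> (beta_crit F b \<sigma>)"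

text \<open>Envelope argument: comparing each minimiser with the potential at the other parameter gives
  two-sided bounds on the increments of the minima.\<close>

lemma gap_increment:
  assumes "deriv F b \<le> \<sigma>" "\<sigma> \<le> \<tau>" "\<tau> \<le> deriv F a"
  shows "(\<tau> - \<sigma>) * (b - a) \<le> gap \<tau> - gap \<sigma>"
    and "gap \<tau> - gap \<sigma> \<le> (\<tau> - \<sigma>) * beta_crit F b (deriv F a)"
proof -
  have s: "deriv F b \<le> \<sigma>" "\<sigma> \<le> deriv F a" and t: "deriv F b \<le> \<tau>" "\<tau> \<le> deriv F a"
    using assms by auto
  note A = alpha_crit[OF s] alpha_crit[OF t] and B = beta_crit[OF s] beta_crit[OF t]
  have "beta_crit F b \<tau> \<le> beta_crit F b (deriv F a)"
    using B t(2) beta_crit[of "deriv F a"] assms dF_less_right_iff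
    by (metis linorder_not_less order.trans order_refl)
  then have m: "(\<tau> - \<sigma>) * beta_crit F b \<tau> \<le> (\<tau> - \<sigma>) * beta_crit F b (deriv F a)"
    using assms by (intro mult_left_mono) auto
  have n: "(\<tau> - \<sigma>) * alpha_crit F a \<sigma> \<ge> 0" "(\<tau> - \<sigma>) * alpha_crit F a \<tau> \<le> (\<tau> - \<sigma>) * a"
    "(\<tau> - \<sigma>) * b \<le> (\<tau> - \<sigma>) * beta_crit F b \<sigma>"
    using assms A B by (auto intro!: mult_left_mono mult_nonneg_nonneg)
  \<comment> \<open>The potential at \<sigma> is compared at the left minimiser of \<tau>, the
    potential at \<tau> at the right minimiser of \<sigma>. What remains is
    \<open>\<tau> - \<sigma>\<close> times a distance of at least \<open>b - a\<close>. The upper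
    bound swaps these roles.\<close>
  show "(\<tau> - \<sigma>) * (b - a) \<le> gap \<tau> - gap \<sigma>"
    using Phi_alpha_crit_le[OF s A(4,5)] Phi_beta_crit_le[OF t B(1)] n
    by (simp add: gap_def Phi_def algebra_simps)
  show "gap \<tau> - gap \<sigma> \<le> (\<tau> - \<sigma>) * beta_crit F b (deriv F a)"
    using Phi_alpha_crit_le[OF t A(1,2)] Phi_beta_crit_le[OF s B(3)] n m
    by (simp add: gap_def Phi_def algebra_simps)
qed

text \<open>The increment bounds make \<open>gap\<close> Lipschitz, so continuity of the critical
  points in \<sigma> need not be studied.\<close>

lemma continuous_on_gap: "continuous_on {deriv F b..deriv F a} gap"
proof -
  define L where "L = beta_crit F b (deriv F a)"
  have "L \<ge> 0"
    using beta_crit[of "deriv F a"] dF_greater_middle[of a b] inflection_points by (auto simp: L_def)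
  have "L-lipschitz_on {deriv F b..deriv F a} gap"
  proof (rule lipschitz_on_leI)
    fix x y assume "x \<in> {deriv F b..deriv F a}" "y \<in> {deriv F b..deriv F a}" "x \<le> y"
    then have "0 \<le> (y - x) * (b - a)" "(y - x) * (b - a) \<le> gap y - gap x"
      "gap y - gap x \<le> (y - x) * L"
      using gap_increment[of x y] inflection_points by (auto simp: L_def)
    then show "dist (gap x) (gap y) \<le> L * dist x y"
      using \<open>x \<le> y\<close> by (simp add: dist_real_def mult.commute)
  qed fact
  then show ?thesis by (rule lipschitz_on_continuous_on)
qed

text \<open>The gap is negative at \<open>F' b\<close> and positive at \<open>F' a\<close>, hence
  has a zero inside. The lower increment bound makes it strictly increasing, hence the zero is
  unique.\<close>

lemma sigma0:
  shows "sigma0 F a b \<in> {deriv F b<..<deriv F a}" "gap (sigma0 F a b) = 0"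
proof -
  have ba: "deriv F b < deriv F a"
    using dF_greater_middle[of a b] inflection_points by auto
  \<comment> \<open>At each end value of \<sigma> one well degenerates into an inflection point,
    while the other stays strictly away from its own.\<close>
  have ends: "alpha_crit F a (deriv F a) = a" "beta_crit F b (deriv F b) = b"
    "b < beta_crit F b (deriv F a)" "alpha_crit F a (deriv F b) < a"
  proof -
    note A = alpha_crit[of "deriv F a"] alpha_crit[of "deriv F b"]
      and B = beta_crit[of "deriv F a"] beta_crit[of "deriv F b"]
    show "alpha_crit F a (deriv F a) = a" "beta_crit F b (deriv F b) = b"
      "b < beta_crit F b (deriv F a)" "alpha_crit F a (deriv F b) < a"
      using A B ba dF_less_left[of "alpha_crit F a (deriv F a)" a]
        dF_less_right[of b "beta_crit F b (deriv F b)"]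
      by (auto simp: order.order_iff_strict)
  qed
  have "gap (deriv F b) < 0"
  proof -
    \<comment> \<open>On this interval \<open>F'\<close> first rises up to \<open>a\<close> and then
      falls to its value at \<open>b\<close>, so the potential increases from the left well up to
      \<open>b\<close>.\<close>
    have "deriv F b < deriv F t" if "alpha_crit F a (deriv F b) < t" "t < b" for t
      using that dF_greater_middle[of t b] dF_less_left[of "alpha_crit F a (deriv F b)" t]
        alpha_crit[of "deriv F b"] ba by (cases "t \<le> a") auto
    then show ?thesis
      using Phi_less[of "alpha_crit F a (deriv F b)" b "deriv F b"] ends
        alpha_crit[of "deriv F b"] ba inflection_points by (auto simp: gap_def)
  qed
  moreover have "gap (deriv F a) > 0"
  proof -
    have "deriv F t < deriv F a" if "a < t" "t < beta_crit F b (deriv F a)" for t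
      using that dF_greater_middle[of a t] dF_less_right[of t "beta_crit F b (deriv F a)"]
        beta_crit[of "deriv F a"] ba by (cases "t \<le> b") auto
    then show ?thesis
      using Phi_greater[of a "beta_crit F b (deriv F a)" "deriv F a"] ends inflection_points
      by (auto simp: gap_def)
  qed
  moreover have "\<exists>\<sigma>\<ge>deriv F b. \<sigma> \<le> deriv F a \<and> gap \<sigma> = 0"
    by (rule IVT') (use calculation ba continuous_on_gap in auto)
  ultimately obtain \<sigma> where \<sigma>: "\<sigma> \<in> {deriv F b<..<deriv F a}" "gap \<sigma> = 0"
    by (metis greaterThanLessThan_iff less_irrefl order_le_less)
  have uniq: "\<tau> = \<sigma>" if "\<tau> \<in> {deriv F b<..<deriv F a}" "gap \<tau> = 0" for \<tau>
  proof (rule ccontr)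
    assume "\<tau> \<noteq> \<sigma>"
    then have "0 < \<bar>\<tau> - \<sigma>\<bar> * (b - a)" using inflection_points by auto
    then show False
      using gap_increment(1)[of \<tau> \<sigma>] gap_increment(1)[of \<sigma> \<tau>] that \<sigma>
      by (auto simp: abs_if split: if_splits)
  qed
  have "\<exists>!\<sigma>. \<sigma> \<in> {deriv F b<..<deriv F a} \<and> gap \<sigma> = 0"
    using \<sigma> uniq by blast
  from theI'[OF this]
  show "sigma0 F a b \<in> {deriv F b<..<deriv F a}" "gap (sigma0 F a b) = 0"
    by (auto simp: sigma0_def gap_def)
qed

lemma alpha0: "0 < alpha0 F a b" "alpha0 F a b < a" "deriv F (alpha0 F a b) = sigma0 F a b"
  using alpha_crit[of "sigma0 F a b"] sigma0(1)
  by (auto simp: alpha0_def order.order_iff_strict)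

lemma beta0: "b < beta0 F a b" "deriv F (beta0 F a b) = sigma0 F a b"
  using beta_crit[of "sigma0 F a b"] sigma0(1)
  by (auto simp: beta0_def order.order_iff_strict)

lemma Phi_beta0: "Phi F (sigma0 F a b) (beta0 F a b) = Phi F (sigma0 F a b) (alpha0 F a b)"
  using sigma0(2) by (simp add: gap_def alpha0_def beta0_def)

text \<open>If \<open>F' x\<close> exceeds the Maxwell value, so does \<open>F'\<close> on all of
  the interval from \<open>alpha0\<close> to \<open>x\<close>, and the potential climbs from the
  left well. Otherwise it descends from \<open>x\<close> to the right well. Both wells have the same
  depth.\<close>

lemma Phi_above_maxwell:
  assumes "alpha0 F a b < x" "x < beta0 F a b"
  shows "Phi F (sigma0 F a b) (alpha0 F a b) < Phi F (sigma0 F a b) x"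
proof (cases "sigma0 F a b < deriv F x")
  case True
  have "sigma0 F a b < deriv F t" if "alpha0 F a b < t" "t < x" for t
  proof -
    consider "t \<le> a" | "a < t" "x \<le> b" | "a < t" "t \<le> b" "b < x" | "b < t" by linarith
    then show ?thesis
    proof cases
      case 1 then show ?thesis using dF_less_left[of "alpha0 F a b" t] alpha0 that by auto
    next
      case 2 then show ?thesis using dF_greater_middle[of t x] True that by auto
    next
      \<comment> \<open>A point \<open>x\<close> between \<open>b\<close> and \<open>beta0\<close>
        has \<open>F' x\<close> below the Maxwell value, so this case and the next are
        contradictory.\<close>
      case 3 then show ?thesis using dF_less_right[of x "beta0 F a b"] beta0 assms True by auto
    next
      case 4 then show ?thesis using dF_less_right[of x "beta0 F a b"] beta0 assms True that by auto
    qed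
  qed
  then show ?thesis using Phi_less[of "alpha0 F a b" x] alpha0 assms by auto
next
  case False
  have "a < x"
    using False dF_less_left[of "alpha0 F a b" x] alpha0 assms by force
  have "deriv F t < sigma0 F a b" if "x < t" "t < beta0 F a b" for t
  proof (cases "t \<le> b")
    case True
    then show ?thesis using dF_greater_middle[of x t] \<open>a < x\<close> False that by auto
  next
    case False
    then show ?thesis using dF_less_right[of t "beta0 F a b"] beta0 that by auto
  qed
  then have "Phi F (sigma0 F a b) (beta0 F a b) < Phi F (sigma0 F a b) x"
    using \<open>a < x\<close> inflection_points assms by (intro Phi_greater) auto
  then show ?thesis using Phi_beta0 by simp
qed

section \<open>Energy of simple and constant solutions\<close>

text \<open>One constant for all admissible pairs. Since \<open>c\<close> lies above the potential
  at \<open>alpha_crit\<close>, the excess is at most a difference of two values of the potential on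
  the fixed interval \<open>{l..u}\<close>, where \<open>F\<close> is bounded.\<close>

lemma Phi_bounded_excess:
  obtains K where "\<And>\<sigma> c x. admissible F a b (\<sigma>, c) \<Longrightarrow> alpha_crit F a \<sigma> \<le> x \<Longrightarrow> x \<le> beta_crit F b \<sigma> \<Longrightarrow>
    Phi F \<sigma> x - c \<le> K" "\<And>\<sigma> c. admissible F a b (\<sigma>, c) \<Longrightarrow> beta_crit F b \<sigma> \<le> K"
proof -
  obtain l u where lu: "0 < l" "l < a" "deriv F l < deriv F b" "b < u" "deriv F a < deriv F u"
    using outer_points by blast
  have "compact (F ` {l..u})"
    using lu by (intro compact_continuous_image continuous_on_subset[OF continuous_on_F]) auto
  then obtain B where "\<forall>x\<in>{l..u}. \<bar>F x\<bar> \<le> B"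
    using compact_imp_bounded[of "F ` {l..u}"] by (auto simp: bounded_iff)
  then have B: "\<bar>F x\<bar> \<le> B" if "l \<le> x" "x \<le> u" for x
    using that by simp
  define S where "S = max \<bar>deriv F a\<bar> \<bar>deriv F b\<bar>"
  have range: "l < alpha_crit F a \<sigma>" "beta_crit F b \<sigma> < u" "\<bar>\<sigma>\<bar> \<le> S"
    if "admissible F a b (\<sigma>, c)" for \<sigma> c
  proof -
    have \<sigma>: "deriv F b < \<sigma>" "\<sigma> < deriv F a" using that by (auto simp: admissible_def)
    with alpha_crit[of \<sigma>] beta_crit[of \<sigma>] lu
    show "l < alpha_crit F a \<sigma>" "beta_crit F b \<sigma> < u" "\<bar>\<sigma>\<bar> \<le> S"
      using dF_less_left_iff[of l "alpha_crit F a \<sigma>"] dF_less_right_iff[of "beta_crit F b \<sigma>" u]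
      by (auto simp: S_def)
  qed
  show thesis
  proof (rule that[of "max u (2 * B + S * (u - l))"])
    fix \<sigma> c x
    assume adm: "admissible F a b (\<sigma>, c)" and x: "alpha_crit F a \<sigma> \<le> x" "x \<le> beta_crit F b \<sigma>"
    define y where "y = alpha_crit F a \<sigma>"
    have "Phi F \<sigma> y < c" using adm by (auto simp: admissible_def y_def)
    moreover have "\<bar>F x\<bar> \<le> B" "\<bar>F y\<bar> \<le> B"
      using range[OF adm] x by (auto intro!: B simp: y_def)
    moreover have "\<bar>\<sigma> * (x - y)\<bar> \<le> S * (u - l)"
      unfolding abs_mult using range[OF adm] x by (intro mult_mono) (auto simp: y_def)
    ultimately show "Phi F \<sigma> x - c \<le> max u (2 * B + S * (u - l))"
      by (auto simp: Phi_def algebra_simps)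
  next
    fix \<sigma> c assume "admissible F a b (\<sigma>, c)"
    from range(2)[OF this] show "beta_crit F b \<sigma> \<le> max u (2 * B + S * (u - l))" by simp
  qed
qed

end

section \<open>Pointwise estimates on the rescaled interval\<close>

lemma dom_end_points_less: "- (1 / \<epsilon>) < 1 / \<epsilon>" if "0 < \<epsilon>" for \<epsilon> :: real
proof -
  have "0 < 1 / \<epsilon>" using that by simp
  then show ?thesis by linarith
qed

lemma D_has_vector_derivative:
  "(z has_vector_derivative D \<epsilon> z x) (at x within dom \<epsilon>)"
  if "z differentiable_on dom \<epsilon>" "x \<in> dom \<epsilon>"
  using that by (simp add: D_def differentiable_on_def vector_derivative_works)

text \<open>Inside, the one-sided notion is the ordinary derivative of a monotone function; at the
  end points the Neumann condition gives zero.\<close>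

lemma D_nonneg:
  assumes "solution F \<epsilon> r z \<sigma>" "mono_on (dom \<epsilon>) z" "x \<in> dom \<epsilon>"
  shows "0 \<le> D \<epsilon> z x"
proof (cases "x \<in> interior (dom \<epsilon>)")
  case True
  have "z differentiable_on dom \<epsilon>" using assms(1) by (simp add: solution_def)
  from D_has_vector_derivative[OF this assms(3)]
  have "(z has_real_derivative D \<epsilon> z x) (at x)"
    unfolding has_real_derivative_iff_has_vector_derivative at_within_interior[OF True] .
  then show ?thesis by (rule mono_on_imp_deriv_nonneg[OF assms(2) _ True])
next
  case False
  then have "x = - (1 / \<epsilon>) \<or> x = 1 / \<epsilon>"
    using assms(3) by (auto simp: dom_def)
  then show ?thesis using assms(1) by (auto simp: solution_def)
qed

text \<open>With \<open>R = sqrt (1 + \<epsilon>\<^sup>2 * s\<^sup>2)\<close> the left side equals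
  \<open>s * (s / R)\<close>, and \<open>2 * P \<epsilon> s\<close> exceeds
  \<open>(s / R)\<^sup>2\<close> by the square \<open>((R - 1) / R)\<^sup>2\<close> divided by
  \<open>\<epsilon>\<^sup>2\<close>. The bound is linear in \<open>s\<close> once \<open>P\<close>
  is bounded, so it integrates to a total variation.\<close>

lemma Q_plus_P_le:
  assumes "0 < \<epsilon>" "0 \<le> s"
  shows "Q (\<epsilon> * s) / \<epsilon>\<^sup>2 + P \<epsilon> s \<le> s * sqrt (2 * P \<epsilon> s)"
proof -
  define R where "R = sqrt (1 + \<epsilon>\<^sup>2 * s\<^sup>2)"
  have R: "1 \<le> R" and R2: "\<epsilon>\<^sup>2 * s\<^sup>2 = R * R - 1"
    by (auto simp: R_def)
  then have s2: "s * s = (R * R - 1) / \<epsilon>\<^sup>2"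
    using assms by (simp add: field_simps power2_eq_square)
  have "(R * R - 1) / (R * R) \<le> 2 * (1 - 1 / R)"
  proof -
    have "2 * (1 - 1 / R) - (R * R - 1) / (R * R) = ((R - 1) / R)\<^sup>2"
      using R by (simp add: field_simps power2_eq_square)
    then show ?thesis by (metis diff_ge_0_iff_ge zero_le_power2)
  qed
  then have "(R * R - 1) / (R * R) / \<epsilon>\<^sup>2 \<le> 2 * (1 - 1 / R) / \<epsilon>\<^sup>2"
    by (rule divide_right_mono) simp
  then have "(s / R)\<^sup>2 \<le> 2 * P \<epsilon> s"
    by (simp add: P_def flip: R_def) (simp add: power2_eq_square s2 mult.commute)
  then have "s * (s / R) \<le> s * sqrt (2 * P \<epsilon> s)"
    using assms by (intro mult_left_mono real_le_rsqrt)
  moreover have "Q (\<epsilon> * s) / \<epsilon>\<^sup>2 + P \<epsilon> s = s * (s / R)"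
    using R assms by (simp add: Q_def P_def power_mult_distrib R_def[symmetric] s2 field_simps power2_eq_square)
  ultimately show ?thesis by simp
qed

lemma integral_dom_const: "integral (dom \<epsilon>) (\<lambda>x. k) = 2 * k / \<epsilon>" if "0 < \<epsilon>"
  using that by (simp add: dom_def)

text \<open>A continuous function that avoids \<open>v\<close> stays on one side of it, and the mean
  \<open>r\<close> decides which. This confines a solution between the two wells.\<close>

lemma greater_of_average_greater:
  fixes z :: "real \<Rightarrow> real"
  assumes "0 < \<epsilon>" "continuous_on (dom \<epsilon>) z" "integral (dom \<epsilon>) z = 2 * r / \<epsilon>" "v < r"
    and "\<And>x. x \<in> dom \<epsilon> \<Longrightarrow> z x \<noteq> v" "x \<in> dom \<epsilon>"
  shows "v < z x"
proof (rule ccontr)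
  assume "\<not> v < z x"
  have "z y \<le> v" if "y \<in> dom \<epsilon>" for y
  proof (rule ccontr)
    assume "\<not> z y \<le> v"
    have "connected (z ` dom \<epsilon>)"
      by (intro connected_continuous_image assms) (simp add: dom_def)
    then have "v \<in> z ` dom \<epsilon>"
      by (rule connectedD_interval[where x="z x" and y="z y"])
         (use that assms \<open>\<not> z y \<le> v\<close> \<open>\<not> v < z x\<close> in auto)
    then show False using assms(5) by blast
  qed
  then have "integral (dom \<epsilon>) z \<le> integral (dom \<epsilon>) (\<lambda>x. v)"
    using assms(2) by (intro integral_le) (auto simp: dom_def intro: integrable_continuous_interval)
  then show False using assms integral_dom_const[of \<epsilon> v] by (simp add: field_simps)
qed

lemma less_of_average_less:
  fixes z :: "real \<Rightarrow> real"
  assumes "0 < \<epsilon>" "continuous_on (dom \<epsilon>) z" "integral (dom \<epsilon>) z = 2 * r / \<epsilon>" "r < v"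
    and "\<And>x. x \<in> dom \<epsilon> \<Longrightarrow> z x \<noteq> v" "x \<in> dom \<epsilon>"
  shows "z x < v"
proof -
  have "- v < - z x"
  proof (rule greater_of_average_greater[where z="\<lambda>x. - z x" and r="- r", OF assms(1)])
    show "continuous_on (dom \<epsilon>) (\<lambda>x. - z x)" by (intro continuous_on_minus assms)
  qed (use assms in simp_all)
  then show ?thesis by simp
qed

text \<open>The mass constraint forces the constant to be \<open>r\<close>, and the factor
  \<epsilon> cancels the interval length up to 2.\<close>

lemma energy_constant_solution:
  assumes "0 < \<epsilon>" "constant_solution F \<epsilon> r w"
  shows "energy F \<epsilon> w = 2 * F r"
proof -
  from assms(2) obtain k \<sigma> where k: "\<And>x. x \<in> dom \<epsilon> \<Longrightarrow> w x = k" and sol: "solution F \<epsilon> r w \<sigma>"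
    by (auto simp: constant_solution_def constant_on_def)
  have "integral (dom \<epsilon>) w = integral (dom \<epsilon>) (\<lambda>x. k)"
    using k by (rule Henstock_Kurzweil_Integration.integral_cong)
  then have kr: "k = r"
    using sol assms integral_dom_const[of \<epsilon> k] by (auto simp: solution_def)
  have "D \<epsilon> w x = 0" if "x \<in> dom \<epsilon>" for x
  proof -
    have "(w has_vector_derivative 0) (at x within dom \<epsilon>)"
      by (rule has_vector_derivative_transform[OF that k]) auto
    moreover have "- (1 / \<epsilon>) < 1 / \<epsilon>"
      using dom_end_points_less[OF assms(1)] .
    ultimately show ?thesis
      using that unfolding D_def dom_def
      by (intro vector_derivative_within_closed_interval)
  qed
  then have "energy F \<epsilon> w = \<epsilon> * integral (dom \<epsilon>) (\<lambda>x. F r)"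
    unfolding energy_def using k kr
    by (intro arg_cong2[where f="(*)"] Henstock_Kurzweil_Integration.integral_cong) (auto simp: Q_def)
  then show ?thesis using assms integral_dom_const[of \<epsilon> "F r"] by simp
qed

text \<open>The constant is chosen before \<epsilon>, \<open>r\<close> and the pair. The integral of
  the pointwise bound is explicit: the mass constraint evaluates the term in \<open>z\<close>, and
  the term in \<open>z'\<close> telescopes to a bounded amplitude, which the factor \<epsilon> in
  the energy makes small.\<close>

lemma energy_simple_solution_le:
  assumes dw: "double_well F a b"
  obtains K where "\<And>\<epsilon> r z \<sigma> c. 0 < \<epsilon> \<Longrightarrow> simple_solution_with_pair F a b \<epsilon> r z (\<sigma>, c) \<Longrightarrow>
    alpha_crit F a \<sigma> < r \<Longrightarrow> r < beta_crit F b \<sigma> \<Longrightarrow> energy F \<epsilon> z \<le> 2 * (c + \<sigma> * r) + K * \<epsilon>"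
proof -
  obtain M where M: "\<And>\<sigma> c x. admissible F a b (\<sigma>, c) \<Longrightarrow> alpha_crit F a \<sigma> \<le> x \<Longrightarrow> x \<le> beta_crit F b \<sigma> \<Longrightarrow>
      Phi F \<sigma> x - c \<le> M" "\<And>\<sigma> c. admissible F a b (\<sigma>, c) \<Longrightarrow> beta_crit F b \<sigma> \<le> M"
    using Phi_bounded_excess[OF dw] by blast
  show thesis
  proof (rule that[of "sqrt (2 * M) * M"])
    fix \<epsilon> r z \<sigma> c
    assume \<epsilon>: "0 < \<epsilon>" and pair: "simple_solution_with_pair F a b \<epsilon> r z (\<sigma>, c)"
      and r: "alpha_crit F a \<sigma> < r" "r < beta_crit F b \<sigma>"
    from pair have sol: "solution F \<epsilon> r z \<sigma>" and mono: "mono_on (dom \<epsilon>) z"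
      and adm: "admissible F a b (\<sigma>, c)"
      and cons: "\<And>x. x \<in> dom \<epsilon> \<Longrightarrow> P \<epsilon> (D \<epsilon> z x) = Phi F \<sigma> (z x) - c"
      by (auto simp: simple_solution_with_pair_def simple_solution_def)
    from sol have zpos: "\<And>x. x \<in> dom \<epsilon> \<Longrightarrow> 0 < z x" and zdiff: "z differentiable_on dom \<epsilon>"
      and Dcont: "continuous_on (dom \<epsilon>) (D \<epsilon> z)" and mean: "integral (dom \<epsilon>) z = 2 * r / \<epsilon>"
      by (auto simp: solution_def)
    have zcont: "continuous_on (dom \<epsilon>) z"
      using zdiff by (rule differentiable_imp_continuous_on)
    have Ppos: "0 \<le> P \<epsilon> s" for s
      unfolding P_def by (intro divide_nonneg_nonneg) (auto simp: divide_le_eq_1)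
    \<comment> \<open>Nonnegativity of \<open>P\<close> keeps the potential along \<open>z\<close>
      at or above \<open>c\<close>, which exceeds both well depths.\<close>
    have avoid: "z x \<noteq> alpha_crit F a \<sigma>" "z x \<noteq> beta_crit F b \<sigma>" if "x \<in> dom \<epsilon>" for x
      using Ppos[of "D \<epsilon> z x"] cons[OF that] adm by (auto simp: admissible_def)
    have between: "alpha_crit F a \<sigma> < z x" "z x < beta_crit F b \<sigma>" if "x \<in> dom \<epsilon>" for x
      using greater_of_average_greater[OF \<epsilon> zcont mean r(1) avoid(1) that]
        less_of_average_less[OF \<epsilon> zcont mean r(2) avoid(2) that] by auto
    have pointwise: "Q (\<epsilon> * D \<epsilon> z x) / \<epsilon>\<^sup>2 + F (z x) \<le> c + \<sigma> * z x + sqrt (2 * M) * D \<epsilon> z x"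
      if "x \<in> dom \<epsilon>" for x
    proof -
      have D0: "0 \<le> D \<epsilon> z x" by (rule D_nonneg[OF sol mono that])
      have "P \<epsilon> (D \<epsilon> z x) \<le> M"
        using M(1)[OF adm] between[OF that] cons[OF that] by simp
      then have "D \<epsilon> z x * sqrt (2 * P \<epsilon> (D \<epsilon> z x)) \<le> D \<epsilon> z x * sqrt (2 * M)"
        using D0 by (intro mult_left_mono) auto
      then show ?thesis
        using Q_plus_P_le[OF \<epsilon> D0] cons[OF that] by (simp add: Phi_def mult.commute)
    qed
    have Fcont: "continuous_on (dom \<epsilon>) (\<lambda>x. F (z x))"
      by (rule continuous_on_compose2[OF continuous_on_F[OF dw] zcont]) (use zpos in auto)
    have "(D \<epsilon> z has_integral z (1 / \<epsilon>) - z (- (1 / \<epsilon>))) {- (1 / \<epsilon>)..1 / \<epsilon>}"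
      using dom_end_points_less[OF \<epsilon>] D_has_vector_derivative[OF zdiff]
      by (intro fundamental_theorem_of_calculus) (auto simp: dom_def)
    then have intD: "(D \<epsilon> z has_integral z (1 / \<epsilon>) - z (- (1 / \<epsilon>))) (dom \<epsilon>)"
      by (simp add: dom_def)
    have intz: "(z has_integral 2 * r / \<epsilon>) (dom \<epsilon>)"
      using mean zcont by (metis dom_def integrable_continuous_interval integrable_integral)
    have intc: "((\<lambda>x. c) has_integral 2 * c / \<epsilon>) (dom \<epsilon>)"
      using has_integral_const_real[of c "- (1 / \<epsilon>)" "1 / \<epsilon>"] \<epsilon> by (simp add: dom_def)
    have "continuous_on (dom \<epsilon>) (\<lambda>x. Q (\<epsilon> * D \<epsilon> z x) / \<epsilon>\<^sup>2 + F (z x))"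
      unfolding Q_def by (intro continuous_intros Dcont Fcont) (use \<epsilon> in simp)
    then have "(\<lambda>x. Q (\<epsilon> * D \<epsilon> z x) / \<epsilon>\<^sup>2 + F (z x)) integrable_on dom \<epsilon>"
      unfolding dom_def by (rule integrable_continuous_interval)
    then have "integral (dom \<epsilon>) (\<lambda>x. Q (\<epsilon> * D \<epsilon> z x) / \<epsilon>\<^sup>2 + F (z x)) \<le>
        2 * c / \<epsilon> + \<sigma> * (2 * r / \<epsilon>) + sqrt (2 * M) * (z (1 / \<epsilon>) - z (- (1 / \<epsilon>)))"
    proof (rule has_integral_le[OF integrable_integral])
      show "((\<lambda>x. c + \<sigma> * z x + sqrt (2 * M) * D \<epsilon> z x) has_integral
          2 * c / \<epsilon> + \<sigma> * (2 * r / \<epsilon>) + sqrt (2 * M) * (z (1 / \<epsilon>) - z (- (1 / \<epsilon>)))) (dom \<epsilon>)"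
        by (intro has_integral_add has_integral_mult_right intc intz intD)
    qed (rule pointwise)
    moreover have "sqrt (2 * M) * (z (1 / \<epsilon>) - z (- (1 / \<epsilon>))) \<le> sqrt (2 * M) * M"
    proof (rule mult_left_mono)
      have ends: "1 / \<epsilon> \<in> dom \<epsilon>" "- (1 / \<epsilon>) \<in> dom \<epsilon>"
        using dom_end_points_less[OF \<epsilon>] by (auto simp: dom_def)
      show "z (1 / \<epsilon>) - z (- (1 / \<epsilon>)) \<le> M"
        using M(2)[OF adm] between(2)[OF ends(1)] zpos[OF ends(2)] by simp
      \<comment> \<open>Needed because the real \<open>sqrt\<close> takes negative values at
        negative arguments.\<close>
      have "0 \<le> M"
        using M(2)[OF adm] between(2)[OF ends(1)] zpos[OF ends(1)] by simp
      then show "0 \<le> sqrt (2 * M)" by simp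
    qed
    ultimately have "integral (dom \<epsilon>) (\<lambda>x. Q (\<epsilon> * D \<epsilon> z x) / \<epsilon>\<^sup>2 + F (z x)) \<le>
        2 * c / \<epsilon> + \<sigma> * (2 * r / \<epsilon>) + sqrt (2 * M) * M" by linarith
    from mult_left_mono[OF this, of \<epsilon>] \<epsilon>
    show "energy F \<epsilon> z \<le> 2 * (c + \<sigma> * r) + sqrt (2 * M) * M * \<epsilon>"
      by (simp add: energy_def algebra_simps)
  qed
qed

text \<open>Transfers the strict inequalities at the Maxwell point to nearby pairs, uniformly in
  \<open>r\<close> by compactness of \<open>R_set\<close>.\<close>

lemma near_maxwell_point:
  assumes dw: "double_well F a b" and \<delta>: "0 < \<delta>" "\<delta> < (beta0 F a b - alpha0 F a b) / 2"
  obtains \<eta> where "0 < \<eta>"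
    "\<And>\<sigma> c r. admissible F a b (\<sigma>, c) \<Longrightarrow> norm ((\<sigma>, c) - maxwell_point F a b) \<le> \<eta> \<Longrightarrow>
       r \<in> R_set F a b \<delta> \<Longrightarrow>
       alpha_crit F a \<sigma> < r \<and> r < beta_crit F b \<sigma> \<and> c + \<eta> \<le> Phi F \<sigma> r"
proof -
  define \<sigma>0 b0 where "\<sigma>0 = sigma0 F a b" and "b0 = Phi F \<sigma>0 (alpha0 F a b)"
  have mp: "maxwell_point F a b = (\<sigma>0, b0)"
    by (simp add: maxwell_point_def \<sigma>0_def b0_def)
  note A0 = alpha0[OF dw] and B0 = beta0[OF dw] and ab = inflection_points[OF dw]
  \<comment> \<open>Probe points on the outer increasing branches of \<open>F'\<close> that enclose
    \<open>R_set\<close>. Comparing \<sigma> with \<open>F'\<close> there locates the critical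
    points without any continuity in \<sigma>.\<close>
  define x y where "x = min (alpha0 F a b + \<delta>) a" and "y = max (beta0 F a b - \<delta>) b"
  have x: "0 < x" "x \<le> a" and y: "b \<le> y"
    using A0 \<delta> ab by (auto simp: x_def y_def)
  have dx: "\<sigma>0 < deriv F x"
    using dF_less_left[OF dw, of "alpha0 F a b" x] A0 \<delta> by (auto simp: x_def \<sigma>0_def)
  have dy: "deriv F y < \<sigma>0"
    using dF_less_right[OF dw, of y "beta0 F a b"] B0 \<delta> by (auto simp: y_def \<sigma>0_def)
  have "compact (R_set F a b \<delta>)" "R_set F a b \<delta> \<noteq> {}" "R_set F a b \<delta> \<subseteq> {0<..}"
    using A0 \<delta> by (auto simp: R_set_def)
  then have "\<exists>r0\<in>R_set F a b \<delta>. \<forall>r\<in>R_set F a b \<delta>. Phi F \<sigma>0 r0 \<le> Phi F \<sigma>0 r"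
    by (intro continuous_attains_inf continuous_on_subset[OF continuous_on_Phi[OF dw]])
  then obtain r0 where r0: "r0 \<in> R_set F a b \<delta>" "\<And>r. r \<in> R_set F a b \<delta> \<Longrightarrow> Phi F \<sigma>0 r0 \<le> Phi F \<sigma>0 r"
    by blast
  define m where "m = Phi F \<sigma>0 r0 - b0"
  have m: "0 < m"
    using Phi_above_maxwell[OF dw, of r0] r0(1) \<delta> by (auto simp: m_def b0_def \<sigma>0_def R_set_def)
  define \<beta> where "\<beta> = beta0 F a b"
  have \<beta>: "0 < \<beta>" using B0 ab by (simp add: \<beta>_def)
  \<comment> \<open>The last two bounds keep \<sigma> strictly between \<open>F' y\<close> and
    \<open>F' x\<close>. The first splits the excess \<open>m\<close> three ways: an error \<eta>
    from \<open>c\<close>, an error \<open>\<eta> * \<beta>\<close> from the tilt, and the margin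
    \<eta> of the conclusion.\<close>
  define \<eta> where "\<eta> = min (m / (2 + \<beta>)) (min ((deriv F x - \<sigma>0) / 2) ((\<sigma>0 - deriv F y) / 2))"
  have \<eta>: "0 < \<eta>" "\<eta> < deriv F x - \<sigma>0" "\<eta> < \<sigma>0 - deriv F y"
    using m \<beta> dx dy by (auto simp: \<eta>_def min_less_iff_disj)
  have "\<eta> \<le> m / (2 + \<beta>)" by (simp add: \<eta>_def)
  then have \<eta>m: "\<eta> * (2 + \<beta>) \<le> m" using \<beta> by (simp add: pos_le_divide_eq)
  show thesis
  proof (rule that[OF \<eta>(1)])
    fix \<sigma> c r
    assume adm: "admissible F a b (\<sigma>, c)" and close: "norm ((\<sigma>, c) - maxwell_point F a b) \<le> \<eta>"
      and r: "r \<in> R_set F a b \<delta>"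
    have d: "\<bar>\<sigma> - \<sigma>0\<bar> \<le> \<eta>" "\<bar>c - b0\<bar> \<le> \<eta>"
      using norm_fst_le[of "\<sigma> - \<sigma>0" "c - b0"] norm_snd_le[of "c - b0" "\<sigma> - \<sigma>0"] close by (auto simp: mp)
    have \<sigma>: "deriv F b \<le> \<sigma>" "\<sigma> \<le> deriv F a" using adm by (auto simp: admissible_def)
    have "deriv F (alpha_crit F a \<sigma>) < deriv F x"
      using alpha_crit[OF dw \<sigma>] d \<eta> by auto
    then have "alpha_crit F a \<sigma> < x"
      using dF_less_left_iff[OF dw] alpha_crit[OF dw \<sigma>] x by blast
    then have 1: "alpha_crit F a \<sigma> < r"
      using r by (auto simp: x_def R_set_def)
    have "deriv F y < deriv F (beta_crit F b \<sigma>)"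
      using beta_crit[OF dw \<sigma>] d \<eta> by auto
    then have "y < beta_crit F b \<sigma>"
      using dF_less_right_iff[OF dw] beta_crit[OF dw \<sigma>] y by blast
    then have 2: "r < beta_crit F b \<sigma>"
      using r by (auto simp: y_def R_set_def)
    have "0 < r" "r \<le> \<beta>" using r A0 \<delta> by (auto simp: R_set_def \<beta>_def)
    then have "(\<sigma> - \<sigma>0) * r \<le> \<eta> * \<beta>"
      using d \<eta> by (intro mult_mono) auto
    then have "c + \<eta> \<le> Phi F \<sigma> r"
      using r0(2)[OF r] d \<eta>m by (simp add: Phi_def m_def algebra_simps)
    with 1 2 show "alpha_crit F a \<sigma> < r \<and> r < beta_crit F b \<sigma> \<and> c + \<eta> \<le> Phi F \<sigma> r" by blast
  qed
qed

text \<open>Follows from \<open>t \<le> exp t\<close>. The linear rate yields an explicit threshold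
  for \<epsilon>; the absolute value covers a negative \<open>K\<close>.\<close>

lemma exp_neg_divide_le: "K * exp (- C / \<epsilon>) \<le> \<bar>K\<bar> * \<epsilon> / C" if "0 < C" "0 < \<epsilon>" for K C \<epsilon> :: real
proof -
  have "C / \<epsilon> \<le> exp (C / \<epsilon>)"
    using exp_ge_add_one_self[of "C / \<epsilon>"] by linarith
  then have "exp (- C / \<epsilon>) \<le> \<epsilon> / C"
    using that by (simp add: exp_minus field_simps)
  then have "\<bar>K\<bar> * exp (- C / \<epsilon>) \<le> \<bar>K\<bar> * (\<epsilon> / C)" by (rule mult_left_mono) simp
  moreover have "K * exp (- C / \<epsilon>) \<le> \<bar>K\<bar> * exp (- C / \<epsilon>)" by (rule mult_right_mono) auto
  ultimately show ?thesis unfolding times_divide_eq_right by (rule order_trans[rotated])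
qed

text \<open>The threshold is chosen before \<open>r\<close>, hence is uniform on
  \<open>R_set\<close>.\<close>

theorem proposition3:
  fixes F :: "real \<Rightarrow> real" and a b \<delta> \<epsilon>1 :: real and N :: "(real \<times> real) set"
    and z :: "real \<Rightarrow> real \<Rightarrow> real \<Rightarrow> real" and \<Delta> :: "real \<Rightarrow> real \<Rightarrow> real \<times> real"
  assumes "double_well F a b"
    and "0 < \<delta>" and "\<delta> < (beta0 F a b - alpha0 F a b) / 2"
    and "maxwell_solutions F a b \<delta> \<epsilon>1 N z \<Delta>"
  shows "\<exists>\<epsilon>\<delta>. 0 < \<epsilon>\<delta> \<and> \<epsilon>\<delta> \<le> \<epsilon>1 \<and>
    (\<forall>\<epsilon>\<in>{0<..<\<epsilon>\<delta>}. \<forall>r\<in>R_set F a b \<delta>. \<forall>w.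
       constant_solution F \<epsilon> r w \<longrightarrow> energy F \<epsilon> (z \<epsilon> r) < energy F \<epsilon> w)"
proof -
  obtain \<eta> where \<eta>: "0 < \<eta>"
    "\<And>\<sigma> c r. admissible F a b (\<sigma>, c) \<Longrightarrow> norm ((\<sigma>, c) - maxwell_point F a b) \<le> \<eta> \<Longrightarrow>
       r \<in> R_set F a b \<delta> \<Longrightarrow>
       alpha_crit F a \<sigma> < r \<and> r < beta_crit F b \<sigma> \<and> c + \<eta> \<le> Phi F \<sigma> r"
    using near_maxwell_point[OF assms(1-3)] by blast
  obtain L where L: "\<And>\<epsilon> r z \<sigma> c. 0 < \<epsilon> \<Longrightarrow> simple_solution_with_pair F a b \<epsilon> r z (\<sigma>, c) \<Longrightarrow>
      alpha_crit F a \<sigma> < r \<Longrightarrow> r < beta_crit F b \<sigma> \<Longrightarrow> energy F \<epsilon> z \<le> 2 * (c + \<sigma> * r) + L * \<epsilon>"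
    using energy_simple_solution_le[OF assms(1)] by blast
  from assms(4) obtain C K where C: "0 < C" and "\<forall>\<^sub>F \<epsilon> in at_right 0. \<forall>r\<in>R_set F a b \<delta>.
      norm (\<Delta> \<epsilon> r - maxwell_point F a b) \<le> K * exp (- C / \<epsilon>)"
    by (auto simp: maxwell_solutions_def)
  then obtain e where e: "0 < e" "\<And>\<epsilon> r. 0 < \<epsilon> \<Longrightarrow> \<epsilon> < e \<Longrightarrow> r \<in> R_set F a b \<delta> \<Longrightarrow>
      norm (\<Delta> \<epsilon> r - maxwell_point F a b) \<le> K * exp (- C / \<epsilon>)"
    by (auto simp: eventually_at_right_field)
  have \<epsilon>1: "0 < \<epsilon>1" and pair: "\<And>\<epsilon> r. 0 < \<epsilon> \<Longrightarrow> \<epsilon> < \<epsilon>1 \<Longrightarrow> r \<in> R_set F a b \<delta> \<Longrightarrow>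
      simple_solution_with_pair F a b \<epsilon> r (z \<epsilon> r) (\<Delta> \<epsilon> r)"
    using assms(4) by (auto simp: maxwell_solutions_def)
  \<comment> \<open>In order: the solution exists, the exponential estimate holds, the energy error
    \<open>L * \<epsilon>\<close> is below \<eta>, and the pair lies within \<eta> of the Maxwell
    point. Adding 1 avoids a zero denominator.\<close>
  define \<epsilon>\<delta> where "\<epsilon>\<delta> = min (min \<epsilon>1 e) (min (\<eta> / (\<bar>L\<bar> + 1)) (\<eta> * C / (\<bar>K\<bar> + 1)))"
  have "energy F \<epsilon> (z \<epsilon> r) < energy F \<epsilon> w"
    if \<epsilon>: "0 < \<epsilon>" "\<epsilon> < \<epsilon>\<delta>" and r: "r \<in> R_set F a b \<delta>" and w: "constant_solution F \<epsilon> r w" for \<epsilon> r w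
  proof -
    obtain \<sigma> c where \<Delta>: "\<Delta> \<epsilon> r = (\<sigma>, c)" by force
    have sol: "simple_solution_with_pair F a b \<epsilon> r (z \<epsilon> r) (\<sigma>, c)"
      using pair[of \<epsilon> r] \<epsilon> r by (simp add: \<epsilon>\<delta>_def \<Delta>)
    then have adm: "admissible F a b (\<sigma>, c)"
      by (simp add: simple_solution_with_pair_def)
    have "\<epsilon> < \<eta> * C / (\<bar>K\<bar> + 1)" using \<epsilon> by (simp add: \<epsilon>\<delta>_def)
    then have "\<bar>K\<bar> * \<epsilon> / C \<le> \<eta>"
      using C \<epsilon> by (simp add: field_simps)
    then have "norm ((\<sigma>, c) - maxwell_point F a b) \<le> \<eta>"
      using e(2)[of \<epsilon> r] exp_neg_divide_le[OF C \<epsilon>(1), of K] \<epsilon> r by (simp add: \<epsilon>\<delta>_def \<Delta>)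
    note near = \<eta>(2)[OF adm this r]
    have "\<epsilon> < \<eta> / (\<bar>L\<bar> + 1)" using \<epsilon> by (simp add: \<epsilon>\<delta>_def)
    then have "\<bar>L\<bar> * \<epsilon> < \<eta>" using \<epsilon> by (simp add: field_simps)
    moreover have "L * \<epsilon> \<le> \<bar>L\<bar> * \<epsilon>"
      by (rule mult_right_mono) (use \<epsilon>(1) in simp_all)
    ultimately have "L * \<epsilon> < \<eta>" by (rule order_le_less_trans[rotated])
    moreover have "energy F \<epsilon> (z \<epsilon> r) \<le> 2 * (c + \<sigma> * r) + L * \<epsilon>"
      using L[OF \<epsilon>(1) sol] near by blast
    \<comment> \<open>The gain over the constant state is \<open>2 * \<eta>\<close>, while the
      energy error is below \<eta>.\<close>
    moreover have "2 * (c + \<sigma> * r) + 2 * \<eta> \<le> 2 * F r"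
      using near by (simp add: Phi_def)
    ultimately show ?thesis
      using energy_constant_solution[OF \<epsilon>(1) w] \<eta>(1) by linarith
  qed
  moreover have "0 < \<epsilon>\<delta>" "\<epsilon>\<delta> \<le> \<epsilon>1"
    using \<epsilon>1 e(1) \<eta>(1) C by (auto simp: \<epsilon>\<delta>_def)
  ultimately show ?thesis by auto
qed

end
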